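(* Let $CC$ be a C-system, $B\subset Ob(CC)$ and $\widetilde{B}\subset\widetilde{Ob}(CC)$. There exists a C-subsystem $CC'$ of $CC$ with $Ob(CC')=B$ and $\widetilde{Ob}(CC')=\widetilde{B}$ if and only if the following conditions hold: (1) $pt\in B$; (2) if $X\in B$ then $ft(X)\in B$; (3) if $s\in\widetilde{B}$ then $\partial(s)\in B$; (4) if $Y\in B$ and $r\in\widetilde{B}$ (and $\widetilde{T}(Y,r)$ is defined) then $\widetilde{T}(Y,r)\in\widetilde{B}$; (5) if $s\in\widetilde{B}$ and $r\in\widetilde{B}$ (and $\widetilde{S}(s,r)$ is defined) then $\widetilde{S}(s,r)\in\widetilde{B}$; (6) if $X\in B$ (and $\delta(X)$ is defined, i.e. $l(X)>0$) then $\delta(X)\in\widetilde{B}$.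
   Context: A pre-category $C$ is a pair of sets $Mor(C)$, $Ob(C)$ with source and target maps $\partial_0,\partial_1:Mor(C)\to Ob(C)$, an identity map $Id:Ob(C)\to Mor(C)$ and a composition satisfying the usual unit and associativity laws (i.e. a small category, considered up to isomorphism and not equivalence). Composition is written in diagrammatic order: for $f:X\to Y$, $g:Y\to Z$ the composite is $f\circ g=fg:X\to Z$. A C0-system is a pre-category $CC$ with: a function $l:Ob(CC)\to\mathbb{N}$; an object $pt$; a map $ft:Ob(CC)\to Ob(CC)$; for each $X\in Ob(CC)$ a morphism $p_X:X\to ft(X)$; for each $X$ with $l(X)>0$ and each morphism $f:Y\to ft(X)$ an object $f^*X$ (also written $f^*(X)$) and a morphism $q(f,X):f^*X\to X$; such that (i) $l^{-1}(0)=\{pt\}$; (ii) if $l(X)>0$ then $l(ft(X))=l(X)-1$; (iii) $ft(pt)=pt$; (iv) $pt$ is a final object; (v) if $l(X)>0$ and $f:Y\to ft(X)$ then $l(f^*X)>0$, $ft(f^*X)=Y$ and $q(f,X)\circ p_X=p_{f^*X}\circ f$; (vi) if $l(X)>0$ then $Id_{ft(X)}^*(X)=X$ and $q(Id_{ft(X)},X)=Id_X$; (vii) if $l(X)>0$, $g:Z\to Y$ and $f:Y\to ft(X)$ then $(gf)^*(X)=g^*(f^*(X))$ and $q(gf,X)=q(g,f^*X)\,q(f,X)$. For $f:Y\to X$ put $ft(f)=f\circ p_X:Y\to ft(X)$. A C-system is a C0-system together with an operation $f\mapsto s_f$ defined for all morphisms $f:Y\to X$ with $l(X)>0$ such that (a)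 $s_f:Y\to (ft(f))^*(X)$; (b) $s_f\circ p_{(ft(f))^*(X)}=Id_Y$; (c) $f=s_f\circ q(ft(f),X)$; (d) if $X=g^*(U)$ where $l(U)>0$ and $g:ft(X)\to ft(U)$, then $s_f=s_{f\circ q(g,U)}$. In a C-system the squares in (v) are pull-back squares. A C-subsystem $CC'$ of $CC$ is a sub-pre-category of the underlying pre-category (subsets $Ob(CC')\subset Ob(CC)$, $Mor(CC')\subset Mor(CC)$ closed under source, target, identities and composition) which is closed under the operations defining the C-system structure: it contains $pt$, and is closed under $ft$, $X\mapsto p_X$, $(f,X)\mapsto f^*X$, $(f,X)\mapsto q(f,X)$ and $f\mapsto s_f$ (whenever these are defined). It is itself a C-system with the induced structure. $\widetilde{Ob}(CC)\subset Mor(CC)$ is the set of morphisms of the form $s:ft(X)\to X$ with $l(X)>0$ and $s\circ p_X=Id_{ft(X)}$; put $\partial(s)=X$. For $l(X)\ge i\ge 0$ and $f:Y\to ft^i(X)$ define inductively objects $f^*(X,i)$ and morphisms $q(f,X,i):f^*(X,i)\to X$ by $f^*(X,0)=Y$, $q(f,X,0)=f$, $f^*(X,i+1)=q(f,ft(X),i)^*(X)$, $q(f,X,i+1)=q(q(f,ft(X),i),X)$. For $i\ge 1$, $(s:ft(X)\to X)\in\widetilde{Ob}(CC)$ with $l(X)\ge i$ and $f:Y\to ft^i(X)$, let $f^*(s,i):f^*(ft(X),i-1)\to f^*(X,i)$ be the unique morphism such that $f^*(s,i)\circ p_{f^*(X,i)}=Id_{f^*(ft(X),i-1)}$ and $f^*(s,i)\circ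 q(f,X,i)=q(f,ft(X),i-1)\circ s$. Partially defined operations: - $\widetilde{T}(Y,r)$ is defined for $Y\in Ob(CC)$, $(r:ft(X)\to X)\in\widetilde{Ob}(CC)$ such that $l(Y)>0$ and there is a (necessarily unique) $i$ with $l(X)\ge i\ge 1$ and $ft(Y)=ft^i(X)$; then $\widetilde{T}(Y,r)=p_Y^*(r,i)$. - $\widetilde{S}(s,r)$ is defined for $(s:ft(Y)\to Y),(r:ft(X)\to X)\in\widetilde{Ob}(CC)$ such that there is a (necessarily unique) $i\ge 1$ with $Y=ft^i(X)$; then $\widetilde{S}(s,r)=s^*(r,i)$. - $\delta(X)$ is defined for $X\in Ob(CC)$ with $l(X)>0$; $\delta(X)=s_{Id_X}:X\to p_X^*(X)$, an element of $\widetilde{Ob}(CC)$. *)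

theory Defs
  imports Main
begin

text \<open>Composition is in diagrammatic order: for \<open>f : X \<rightarrow> Y\<close> and \<open>g : Y \<rightarrow> Z\<close> the composite is
  \<open>f \<cdot> g : X \<rightarrow> Z\<close>. As in HOL-Algebra, all operations are total HOL functions whose values matter
  only on the carriers \<open>Ob\<close> and \<open>Mor\<close> and only where the mathematical operation is defined.\<close>

record ('o, 'm) precategory =
  Ob :: "'o set"
  Mor :: "'m set"
  src :: "'m \<Rightarrow> 'o"
  tgt :: "'m \<Rightarrow> 'o"
  ident :: "'o \<Rightarrow> 'm"
  cmp :: "'m \<Rightarrow> 'm \<Rightarrow> 'm"  (infixl "\<cdot>\<index>" 70)

definition hom :: "('o, 'm, 'z) precategory_scheme \<Rightarrow> 'o \<Rightarrow> 'o \<Rightarrow> 'm set" where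
  "hom C X Y = {f \<in> Mor C. src C f = X \<and> tgt C f = Y}"

locale precategory =
  fixes C :: "('o, 'm, 'z) precategory_scheme" (structure)
  assumes src_closed: "f \<in> Mor C \<Longrightarrow> src C f \<in> Ob C"
    and tgt_closed: "f \<in> Mor C \<Longrightarrow> tgt C f \<in> Ob C"
    and ident_hom: "X \<in> Ob C \<Longrightarrow> ident C X \<in> hom C X X"
    and cmp_hom: "\<lbrakk>f \<in> hom C X Y; g \<in> hom C Y Z\<rbrakk> \<Longrightarrow> f \<cdot> g \<in> hom C X Z"
    and ident_left: "f \<in> hom C X Y \<Longrightarrow> ident C X \<cdot> f = f"
    and ident_right: "f \<in> hom C X Y \<Longrightarrow> f \<cdot> ident C Y = f"
    and cmp_assoc: "\<lbrakk>f \<in> hom C W X; g \<in> hom C X Y; h \<in> hom C Y Z\<rbrakk> \<Longrightarrow> (f \<cdot> g) \<cdot> h = f \<cdot> (g \<cdot> h)"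

text \<open>\<open>pb C f X\<close> is the object \<open>f\<^sup>*X\<close>, and \<open>qm C f X : f\<^sup>*X \<rightarrow> X\<close> is the morphism \<open>q(f,X)\<close>; both
  are meaningful only if \<open>len C X > 0\<close> and \<open>f\<close> has target \<open>ft C X\<close>.\<close>

record ('o, 'm) c0_system = "('o, 'm) precategory" +
  len :: "'o \<Rightarrow> nat"
  pt :: 'o
  ft :: "'o \<Rightarrow> 'o"
  proj :: "'o \<Rightarrow> 'm"
  pb :: "'m \<Rightarrow> 'o \<Rightarrow> 'o"
  qm :: "'m \<Rightarrow> 'o \<Rightarrow> 'm"

locale c0_system = precategory C
  for C :: "('o, 'm, 'z) c0_system_scheme" (structure) +
  assumes pt_closed: "pt C \<in> Ob C"
    and ft_closed: "X \<in> Ob C \<Longrightarrow> ft C X \<in> Ob C"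
    and proj_hom: "X \<in> Ob C \<Longrightarrow> proj C X \<in> hom C X (ft C X)"
    and pb_closed:
      "\<lbrakk>X \<in> Ob C; len C X > 0; f \<in> hom C Y (ft C X)\<rbrakk> \<Longrightarrow> pb C f X \<in> Ob C"
    and qm_hom:
      "\<lbrakk>X \<in> Ob C; len C X > 0; f \<in> hom C Y (ft C X)\<rbrakk> \<Longrightarrow> qm C f X \<in> hom C (pb C f X) X"
    and len_0: "{X \<in> Ob C. len C X = 0} = {pt C}"
    and len_ft: "\<lbrakk>X \<in> Ob C; len C X > 0\<rbrakk> \<Longrightarrow> len C (ft C X) = len C X - 1"
    and ft_pt: "ft C (pt C) = pt C"
    and pt_final: "X \<in> Ob C \<Longrightarrow> \<exists>!f. f \<in> hom C X (pt C)"
    and len_pb: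
      "\<lbrakk>X \<in> Ob C; len C X > 0; f \<in> hom C Y (ft C X)\<rbrakk> \<Longrightarrow> len C (pb C f X) > 0"
    and ft_pb:
      "\<lbrakk>X \<in> Ob C; len C X > 0; f \<in> hom C Y (ft C X)\<rbrakk> \<Longrightarrow> ft C (pb C f X) = Y"
    and qm_proj:
      "\<lbrakk>X \<in> Ob C; len C X > 0; f \<in> hom C Y (ft C X)\<rbrakk>
        \<Longrightarrow> qm C f X \<cdot> proj C X = proj C (pb C f X) \<cdot> f"
    and pb_ident: "\<lbrakk>X \<in> Ob C; len C X > 0\<rbrakk> \<Longrightarrow> pb C (ident C (ft C X)) X = X"
    and qm_ident: "\<lbrakk>X \<in> Ob C; len C X > 0\<rbrakk> \<Longrightarrow> qm C (ident C (ft C X)) X = ident C X"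
    and pb_cmp:
      "\<lbrakk>X \<in> Ob C; len C X > 0; g \<in> hom C Z Y; f \<in> hom C Y (ft C X)\<rbrakk>
        \<Longrightarrow> pb C (g \<cdot> f) X = pb C g (pb C f X)"
    and qm_cmp:
      "\<lbrakk>X \<in> Ob C; len C X > 0; g \<in> hom C Z Y; f \<in> hom C Y (ft C X)\<rbrakk>
        \<Longrightarrow> qm C (g \<cdot> f) X = qm C g (pb C f X) \<cdot> qm C f X"

definition ft_mor :: "('o, 'm, 'z) c0_system_scheme \<Rightarrow> 'm \<Rightarrow> 'm" where
  "ft_mor C f = f \<cdot>\<^bsub>C\<^esub> proj C (tgt C f)"

record ('o, 'm) c_system = "('o, 'm) c0_system" +
  smor :: "'m \<Rightarrow> 'm"

locale c_system = c0_system C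
  for C :: "('o, 'm, 'z) c_system_scheme" (structure) +
  assumes smor_hom:
      "\<lbrakk>f \<in> hom C Y X; len C X > 0\<rbrakk> \<Longrightarrow> smor C f \<in> hom C Y (pb C (ft_mor C f) X)"
    and smor_section:
      "\<lbrakk>f \<in> hom C Y X; len C X > 0\<rbrakk> \<Longrightarrow> smor C f \<cdot> proj C (pb C (ft_mor C f) X) = ident C Y"
    and smor_factor:
      "\<lbrakk>f \<in> hom C Y X; len C X > 0\<rbrakk> \<Longrightarrow> f = smor C f \<cdot> qm C (ft_mor C f) X"
    and smor_qm:
      "\<lbrakk>f \<in> hom C Y X; len C X > 0; U \<in> Ob C; len C U > 0;
        g \<in> hom C (ft C X) (ft C U); X = pb C g U\<rbrakk>
        \<Longrightarrow> smor C f = smor C (f \<cdot> qm C g U)"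

text \<open>A C-subsystem is represented by the record with the smaller carriers and the same
  operations, so that \<open>Ob\<close>, \<open>Ob_tilde\<close> etc. can be applied to it.\<close>

definition c_subsystem :: "('o, 'm) c_system \<Rightarrow> ('o, 'm) c_system \<Rightarrow> bool" where
  "c_subsystem C' C \<longleftrightarrow>
     C' = C\<lparr>Ob := Ob C', Mor := Mor C'\<rparr> \<and>
     Ob C' \<subseteq> Ob C \<and> Mor C' \<subseteq> Mor C \<and>
     (\<forall>f \<in> Mor C'. src C f \<in> Ob C' \<and> tgt C f \<in> Ob C') \<and>
     (\<forall>X \<in> Ob C'. ident C X \<in> Mor C') \<and>
     (\<forall>f \<in> Mor C'. \<forall>g \<in> Mor C'. tgt C f = src C g \<longrightarrow> f \<cdot>\<^bsub>C\<^esub> g \<in> Mor C') \<and>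
     pt C \<in> Ob C' \<and>
     (\<forall>X \<in> Ob C'. ft C X \<in> Ob C') \<and>
     (\<forall>X \<in> Ob C'. proj C X \<in> Mor C') \<and>
     (\<forall>X \<in> Ob C'. \<forall>f \<in> Mor C'. len C X > 0 \<and> tgt C f = ft C X \<longrightarrow>
        pb C f X \<in> Ob C' \<and> qm C f X \<in> Mor C') \<and>
     (\<forall>f \<in> Mor C'. len C (tgt C f) > 0 \<longrightarrow> smor C f \<in> Mor C')"

text \<open>A C-subsystem is itself a C-system with the induced structure.\<close>

lemma c_subsystem_c_system:
  assumes "c_system C" and sub: "c_subsystem C' C"
  shows "c_system C'"
proof -
  interpret c_system C by fact
  obtain O' M' where C': "C' = C\<lparr>Ob := O', Mor := M'\<rparr>"
    using sub unfolding c_subsystem_def by blast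
  have Ob': "O' \<subseteq> Ob C" and Mor': "M' \<subseteq> Mor C"
    and st: "\<And>f. f \<in> M' \<Longrightarrow> src C f \<in> O'" "\<And>f. f \<in> M' \<Longrightarrow> tgt C f \<in> O'"
    and id: "\<And>X. X \<in> O' \<Longrightarrow> ident C X \<in> M'"
    and cm: "\<And>f g. \<lbrakk>f \<in> M'; g \<in> M'; tgt C f = src C g\<rbrakk> \<Longrightarrow> f \<cdot>\<^bsub>C\<^esub> g \<in> M'"
    and pt: "pt C \<in> O'" and ft: "\<And>X. X \<in> O' \<Longrightarrow> ft C X \<in> O'"
    and pr: "\<And>X. X \<in> O' \<Longrightarrow> proj C X \<in> M'"
    and pbq: "\<And>X f. \<lbrakk>X \<in> O'; f \<in> M'; len C X > 0; tgt C f = ft C X\<rbrakk> \<Longrightarrow> pb C f X \<in> O'"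
      "\<And>X f. \<lbrakk>X \<in> O'; f \<in> M'; len C X > 0; tgt C f = ft C X\<rbrakk> \<Longrightarrow> qm C f X \<in> M'"
    and sm: "\<And>f. \<lbrakk>f \<in> M'; len C (tgt C f) > 0\<rbrakk> \<Longrightarrow> smor C f \<in> M'"
    using sub unfolding c_subsystem_def C' by auto
  have hom': "f \<in> hom C' X Y \<longleftrightarrow> f \<in> hom C X Y \<and> f \<in> M'" for f X Y
    using Mor' by (auto simp: hom_def C')
  have homC: "f \<in> hom C X Y \<longleftrightarrow> f \<in> Mor C \<and> src C f = X \<and> tgt C f = Y" for f X Y
    by (auto simp: hom_def)
  have [simp]: "Ob C' = O'" "Mor C' = M'" "src C' = src C" "tgt C' = tgt C" "ident C' = ident C"
    "cmp C' = cmp C" "len C' = len C" "pt C' = pt C" "ft C' = ft C"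
    "proj C' = proj C" "pb C' = pb C" "qm C' = qm C" "smor C' = smor C" "ft_mor C' = ft_mor C"
    by (auto simp: C' ft_mor_def fun_eq_iff)
  have final: "\<exists>f. f \<in> hom C X (pt C) \<and> f \<in> M'" if "X \<in> O'" for X
    using that
  proof (induction "len C X" arbitrary: X)
    case 0
    then have "X \<in> {X \<in> Ob C. len C X = 0}" using Ob' by auto
    then have "X = pt C" unfolding len_0 by simp
    then show ?case using id[OF pt] ident_hom[OF pt_closed] by auto
  next
    case (Suc n)
    have X: "X \<in> Ob C" using Suc.prems Ob' by blast
    have "n = len C (ft C X)" using len_ft[OF X] Suc.hyps(2) by simp
    then obtain f where f: "f \<in> hom C (ft C X) (pt C)" "f \<in> M'"
      using Suc.hyps(1) ft[OF Suc.prems] by blast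
    have p: "proj C X \<in> hom C X (ft C X)" by (rule proj_hom[OF X])
    have "proj C X \<cdot>\<^bsub>C\<^esub> f \<in> M'"
      using cm[OF pr[OF Suc.prems] f(2)] p f(1) by (simp add: homC)
    then show ?case using cmp_hom[OF p f(1)] by blast
  qed
  have Ob: "X \<in> Ob C" if "X \<in> O'" for X
    using that Ob' by blast
  have ax: "c_system_axioms C'" "c0_system_axioms C'" "precategory C'"
  proof -
    show "precategory C'"
    proof
      show "ident C' X \<in> hom C' X X" if "X \<in> Ob C'" for X
        using that id ident_hom[OF Ob] by (simp add: hom')
      show "f \<cdot>\<^bsub>C'\<^esub> g \<in> hom C' X Z" if "f \<in> hom C' X Y" "g \<in> hom C' Y Z" for f g X Y Z
        using that cmp_hom[of f X Y g Z] cm[of f g] by (simp add: hom') (simp add: homC)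
    qed (use st in \<open>auto simp: hom' intro: ident_left ident_right cmp_assoc\<close>)
    show "c0_system_axioms C'"
    proof
      show "{X \<in> Ob C'. len C' X = 0} = {pt C'}"
        using len_0 Ob' pt by auto
      show "\<exists>!f. f \<in> hom C' X (pt C')" if "X \<in> Ob C'" for X
        using that final[of X] pt_final[OF Ob, of X] by (simp add: hom') blast
      show "proj C' X \<in> hom C' X (ft C' X)" if "X \<in> Ob C'" for X
        using that pr proj_hom[OF Ob] by (simp add: hom')
      show "pb C' f X \<in> Ob C'"
        if "X \<in> Ob C'" "len C' X > 0" "f \<in> hom C' Y (ft C' X)" for f X Y
        using that pbq(1)[of X f] by (simp add: hom' homC)
      show "qm C' f X \<in> hom C' (pb C' f X) X"
        if "X \<in> Ob C'" "len C' X > 0" "f \<in> hom C' Y (ft C' X)" for f X Y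
        using that pbq(2)[of X f] qm_hom[OF Ob, of X f Y] by (simp add: hom') (simp add: homC)
    qed (auto simp: hom' pt ft ft_pt Ob len_ft intro: Ob len_pb ft_pb qm_proj pb_ident qm_ident
        pb_cmp qm_cmp)
    show "c_system_axioms C'"
    proof
      fix f Y X assume f: "f \<in> hom C' Y X" and X: "len C' X > 0"
      then have fC: "f \<in> hom C Y X" "f \<in> M'" "len C X > 0" by (simp_all add: hom')
      show "smor C' f \<in> hom C' Y (pb C' (ft_mor C' f) X)"
        using smor_hom[OF fC(1,3)] sm[OF fC(2)] fC by (simp add: hom') (simp add: homC)
      show "smor C' f \<cdot>\<^bsub>C'\<^esub> proj C' (pb C' (ft_mor C' f) X) = ident C' Y"
        using smor_section[OF fC(1,3)] by simp
      show "f = smor C' f \<cdot>\<^bsub>C'\<^esub> qm C' (ft_mor C' f) X"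
        using smor_factor[OF fC(1,3)] by simp
      fix U g assume "U \<in> Ob C'" "len C' U > 0" "g \<in> hom C' (ft C' X) (ft C' U)" "X = pb C' g U"
      then show "smor C' f = smor C' (f \<cdot>\<^bsub>C'\<^esub> qm C' g U)"
        using smor_qm[OF fC(1,3) Ob, of U g] by (simp add: hom')
    qed
  qed
  then show ?thesis
    by (simp add: c_system_def c0_system_def)
qed

definition Ob_tilde :: "('o, 'm, 'z) c0_system_scheme \<Rightarrow> 'm set" where
  "Ob_tilde C = {s \<in> Mor C. len C (tgt C s) > 0 \<and> src C s = ft C (tgt C s) \<and>
     s \<cdot>\<^bsub>C\<^esub> proj C (tgt C s) = ident C (ft C (tgt C s))}"

definition bd :: "('o, 'm, 'z) c0_system_scheme \<Rightarrow> 'm \<Rightarrow> 'o" where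
  "bd C s = tgt C s"

text \<open>\<open>q_iter C f X i\<close> is \<open>q(f,X,i)\<close> and \<open>pb_iter C f X i\<close> is \<open>f\<^sup>*(X,i)\<close>, for \<open>f : Y \<rightarrow> ft\<^sup>i(X)\<close>
  and \<open>i \<le> l(X)\<close>.\<close>

primrec q_iter :: "('o, 'm, 'z) c0_system_scheme \<Rightarrow> 'm \<Rightarrow> 'o \<Rightarrow> nat \<Rightarrow> 'm" where
  "q_iter C f X 0 = f"
| "q_iter C f X (Suc i) = qm C (q_iter C f (ft C X) i) X"

primrec pb_iter :: "('o, 'm, 'z) c0_system_scheme \<Rightarrow> 'm \<Rightarrow> 'o \<Rightarrow> nat \<Rightarrow> 'o" where
  "pb_iter C f X 0 = src C f"
| "pb_iter C f X (Suc i) = pb C (q_iter C f (ft C X) i) X"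

text \<open>\<open>sec_iter C f s i\<close> is \<open>f\<^sup>*(s,i)\<close>, for \<open>s : ft(X) \<rightarrow> X\<close> in \<open>Ob_tilde C\<close>, \<open>f : Y \<rightarrow> ft\<^sup>i(X)\<close> and
  \<open>1 \<le> i \<le> l(X)\<close>.\<close>

definition sec_iter :: "('o, 'm, 'z) c0_system_scheme \<Rightarrow> 'm \<Rightarrow> 'm \<Rightarrow> nat \<Rightarrow> 'm" where
  "sec_iter C f s i = (let X = bd C s in
     THE h. h \<in> hom C (pb_iter C f (ft C X) (i - 1)) (pb_iter C f X i) \<and>
       h \<cdot>\<^bsub>C\<^esub> proj C (pb_iter C f X i) = ident C (pb_iter C f (ft C X) (i - 1)) \<and>
       h \<cdot>\<^bsub>C\<^esub> q_iter C f X i = q_iter C f (ft C X) (i - 1) \<cdot>\<^bsub>C\<^esub> s)"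

definition T_index :: "('o, 'm, 'z) c0_system_scheme \<Rightarrow> 'o \<Rightarrow> 'm \<Rightarrow> nat \<Rightarrow> bool" where
  "T_index C Y r i \<longleftrightarrow> len C Y > 0 \<and> 1 \<le> i \<and> i \<le> len C (bd C r) \<and> ft C Y = (ft C ^^ i) (bd C r)"

definition T_defined :: "('o, 'm, 'z) c0_system_scheme \<Rightarrow> 'o \<Rightarrow> 'm \<Rightarrow> bool" where
  "T_defined C Y r \<longleftrightarrow> Y \<in> Ob C \<and> r \<in> Ob_tilde C \<and> (\<exists>i. T_index C Y r i)"

definition T_tilde :: "('o, 'm, 'z) c0_system_scheme \<Rightarrow> 'o \<Rightarrow> 'm \<Rightarrow> 'm" where
  "T_tilde C Y r = sec_iter C (proj C Y) r (THE i. T_index C Y r i)"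

definition S_index :: "('o, 'm, 'z) c0_system_scheme \<Rightarrow> 'm \<Rightarrow> 'm \<Rightarrow> nat \<Rightarrow> bool" where
  "S_index C s r i \<longleftrightarrow> 1 \<le> i \<and> bd C s = (ft C ^^ i) (bd C r)"

definition S_defined :: "('o, 'm, 'z) c0_system_scheme \<Rightarrow> 'm \<Rightarrow> 'm \<Rightarrow> bool" where
  "S_defined C s r \<longleftrightarrow> s \<in> Ob_tilde C \<and> r \<in> Ob_tilde C \<and> (\<exists>i. S_index C s r i)"

definition S_tilde :: "('o, 'm, 'z) c0_system_scheme \<Rightarrow> 'm \<Rightarrow> 'm \<Rightarrow> 'm" where
  "S_tilde C s r = sec_iter C s r (THE i. S_index C s r i)"

definition delta_defined :: "('o, 'm, 'z) c_system_scheme \<Rightarrow> 'o \<Rightarrow> bool" where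
  "delta_defined C X \<longleftrightarrow> X \<in> Ob C \<and> len C X > 0"

definition delta :: "('o, 'm, 'z) c_system_scheme \<Rightarrow> 'o \<Rightarrow> 'm" where
  "delta C X = smor C (ident C X)"

end

theory Submission imports Defs begin

text \<open>For the substantial direction take as morphisms of the subsystem all \<open>f : Y \<rightarrow> X\<close> with
  \<open>X, Y \<in> B\<close> such that \<open>f\<^sup>*(r,i) \<in> Bt\<close> whenever \<open>r \<in> Bt\<close> and \<open>f\<^sup>*(r,i)\<close> makes sense. These contain
  the projections (by the operation \<open>T\<close>) and \<open>Bt\<close> (by \<open>S\<close>). They are closed under composition since
  \<open>(fg)\<^sup>*(r,i) = f\<^sup>*(g\<^sup>*(r,i),i)\<close> and under \<open>q\<close> since \<open>q(f,Z)\<^sup>*(r,i) = f\<^sup>*(r,i+1)\<close>. Because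
  \<open>s\<^sub>f = f\<^sup>*(\<delta>(X),1)\<close>, the sections \<open>s\<^sub>f\<close> lie in \<open>Bt\<close>; as a section \<open>s\<close> satisfies \<open>s\<^sub>s = s\<close>, no
  sections outside \<open>Bt\<close> arise. Finally \<open>f\<^sup>*X\<close> is the \<open>ft\<close> of the boundary of \<open>f\<^sup>*(\<delta>(X),2)\<close>, hence in
  \<open>B\<close>. All identities between sections rest on \<open>f\<^sup>*(r,i) = s\<^sub>h\<close> with \<open>h = q(f,ft(X),i-1) r\<close>.\<close>

section \<open>Lengths and iterates of \<open>ft\<close>\<close>

context precategory
begin

lemma hom_src: "f \<in> hom C X Y \<Longrightarrow> X \<in> Ob C"
  using src_closed by (auto simp: hom_def)

lemma hom_tgt: "f \<in> hom C X Y \<Longrightarrow> Y \<in> Ob C"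
  using tgt_closed by (auto simp: hom_def)

end

context c0_system
begin

lemma ft_mor_ident: "X \<in> Ob C \<Longrightarrow> ft_mor C (ident C X) = proj C X"
  using ident_hom[of X] ident_left[OF proj_hom, of X] by (simp add: ft_mor_def hom_def)

lemma len_funpow_ft: "X \<in> Ob C \<Longrightarrow> i \<le> len C X \<Longrightarrow> len C ((ft C ^^ i) X) = len C X - i"
proof (induction i arbitrary: X)
  case (Suc i)
  then have "len C ((ft C ^^ i) (ft C X)) = len C (ft C X) - i"
    by (intro Suc.IH) (simp_all add: ft_closed len_ft)
  then show ?case using Suc.prems by (simp add: funpow_swap1 len_ft)
qed simp

lemma len_0_iff: "X \<in> Ob C \<Longrightarrow> len C X = 0 \<longleftrightarrow> X = pt C"
  using len_0 pt_closed by auto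

lemma len_pt: "len C (pt C) = 0"
  using len_0_iff[OF pt_closed] by simp

lemma funpow_ft_closed: "X \<in> Ob C \<Longrightarrow> (ft C ^^ i) X \<in> Ob C"
  by (induction i) (auto intro: ft_closed)

text \<open>The length drops to 0 after \<open>len C X\<close> steps, where the only object is
  \<open>pt C\<close>, and \<open>ft\<close> fixes it. This controls indices for which no upper
  bound is assumed, as in \<open>S_index\<close>.\<close>

lemma funpow_ft_beyond_len:
  assumes "X \<in> Ob C" "len C X \<le> i"
  shows "(ft C ^^ i) X = pt C"
proof -
  have "(ft C ^^ (n + len C X)) X = pt C" for n
  proof (induction n)
    case 0
    then show ?case
      using assms len_funpow_ft[of X "len C X"] len_0_iff[OF funpow_ft_closed] by simp
  qed (simp add: ft_pt)
  from this[of "i - len C X"] show ?thesis using assms(2) by simp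
qed

section \<open>Iterated pull-backs along a tower of projections\<close>

lemma q_iter_hom:
  "\<lbrakk>X \<in> Ob C; i \<le> len C X; f \<in> hom C Y ((ft C ^^ i) X)\<rbrakk>
    \<Longrightarrow> q_iter C f X i \<in> hom C (pb_iter C f X i) X"
proof (induction i arbitrary: X)
  case 0
  then show ?case by (simp add: hom_def)
next
  case (Suc i)
  then have "q_iter C f (ft C X) i \<in> hom C (pb_iter C f (ft C X) i) (ft C X)"
    by (intro Suc.IH) (simp_all add: ft_closed len_ft funpow_swap1)
  with Suc.prems show ?case by (auto intro: qm_hom)
qed

lemma pb_iter_closed:
  "\<lbrakk>X \<in> Ob C; i \<le> len C X; f \<in> hom C Y ((ft C ^^ i) X)\<rbrakk> \<Longrightarrow> pb_iter C f X i \<in> Ob C"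
  using q_iter_hom hom_src by blast

lemma q_iter_prev_hom:
  assumes "X \<in> Ob C" "Suc i \<le> len C X" "f \<in> hom C Y ((ft C ^^ Suc i) X)"
  shows "q_iter C f (ft C X) i \<in> hom C (pb_iter C f (ft C X) i) (ft C X)"
  using assms by (intro q_iter_hom) (simp_all add: ft_closed len_ft funpow_swap1)

lemma ft_pb_iter_Suc:
  assumes "X \<in> Ob C" "Suc i \<le> len C X" "f \<in> hom C Y ((ft C ^^ Suc i) X)"
  shows "ft C (pb_iter C f X (Suc i)) = pb_iter C f (ft C X) i"
  using ft_pb[OF assms(1) _ q_iter_prev_hom[OF assms]] assms(2) by simp

lemma len_pb_Suc:
  assumes "X \<in> Ob C" "len C X > 0" "f \<in> hom C Y (ft C X)"
  shows "len C (pb C f X) = Suc (len C Y)"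
  using len_ft[OF pb_closed[OF assms] len_pb[OF assms]] len_pb[OF assms] ft_pb[OF assms]
  by simp

lemma len_pb_iter:
  "\<lbrakk>X \<in> Ob C; i \<le> len C X; f \<in> hom C Y ((ft C ^^ i) X)\<rbrakk>
    \<Longrightarrow> len C (pb_iter C f X i) = len C Y + i"
proof (induction i arbitrary: X)
  case 0
  then show ?case by (simp add: hom_def)
next
  case (Suc i)
  have "len C (pb_iter C f (ft C X) i) = len C Y + i"
    using Suc.prems by (intro Suc.IH) (simp_all add: ft_closed len_ft funpow_swap1)
  then show ?case
    using len_pb_Suc[OF Suc.prems(1) _ q_iter_prev_hom[OF Suc.prems]] Suc.prems(2) by simp
qed

lemma funpow_ft_pb_iter:
  "\<lbrakk>X \<in> Ob C; i \<le> len C X; f \<in> hom C Y ((ft C ^^ i) X)\<rbrakk>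
    \<Longrightarrow> (ft C ^^ i) (pb_iter C f X i) = Y"
proof (induction i arbitrary: X)
  case 0
  then show ?case by (simp add: hom_def)
next
  case (Suc i)
  have "(ft C ^^ i) (pb_iter C f (ft C X) i) = Y"
    using Suc.prems by (intro Suc.IH) (simp_all add: ft_closed len_ft funpow_swap1)
  then show ?case
    using ft_pb_iter_Suc[OF Suc.prems] by (simp add: funpow_swap1)
qed

lemma q_iter_ident:
  "\<lbrakk>X \<in> Ob C; i \<le> len C X\<rbrakk> \<Longrightarrow> q_iter C (ident C ((ft C ^^ i) X)) X i = ident C X"
proof (induction i arbitrary: X)
  case (Suc i)
  then have "q_iter C (ident C ((ft C ^^ i) (ft C X))) (ft C X) i = ident C (ft C X)"
    by (intro Suc.IH) (simp_all add: ft_closed len_ft)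
  with Suc.prems show ?case by (simp add: funpow_swap1 qm_ident)
qed simp

text \<open>Functoriality of a single pull-back, applied level by level. The object at level i+1 is
  a pull-back along the morphism at level i, so the induction has to carry the identity for
  morphisms along with the one for objects.\<close>

lemma iter_cmp:
  "\<lbrakk>X \<in> Ob C; i \<le> len C X; f \<in> hom C Z Y; g \<in> hom C Y ((ft C ^^ i) X)\<rbrakk>
    \<Longrightarrow> pb_iter C (f \<cdot> g) X i = pb_iter C f (pb_iter C g X i) i
      \<and> q_iter C (f \<cdot> g) X i = q_iter C f (pb_iter C g X i) i \<cdot> q_iter C g X i"
proof (induction i arbitrary: X)
  case 0
  then have "f \<cdot> g \<in> hom C Z X" by (auto intro: cmp_hom)
  with 0 show ?case by (simp add: hom_def)
next
  case (Suc i)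
  let ?X = "ft C X" and ?V = "pb_iter C g X (Suc i)"
  let ?qg = "q_iter C g ?X i" and ?qf = "q_iter C f (pb_iter C g ?X i) i"
  have X: "?X \<in> Ob C" "i \<le> len C ?X" "g \<in> hom C Y ((ft C ^^ i) ?X)"
    using Suc.prems by (simp_all add: ft_closed len_ft funpow_swap1)
  have qg: "?qg \<in> hom C (pb_iter C g ?X i) ?X" by (rule q_iter_hom[OF X])
  have qf: "?qf \<in> hom C (pb_iter C f (pb_iter C g ?X i) i) (pb_iter C g ?X i)"
    using pb_iter_closed[OF X] len_pb_iter[OF X] funpow_ft_pb_iter[OF X] Suc.prems(3)
    by (intro q_iter_hom) auto
  \<comment> \<open>The recursion for \<open>f\<close> over \<open>?V\<close> descends to
    \<open>ft C ?V\<close>; this identification lets the induction hypothesis apply there.\<close>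
  have "ft C ?V = pb_iter C g ?X i"
    using Suc.prems by (intro ft_pb_iter_Suc) auto
  moreover have "q_iter C (f \<cdot> g) ?X i = ?qf \<cdot> ?qg"
    using Suc.IH[OF X(1,2) Suc.prems(3) X(3)] by blast
  moreover have "0 < len C X" using Suc.prems by simp
  ultimately show ?case
    using pb_cmp[OF Suc.prems(1) _ qf qg] qm_cmp[OF Suc.prems(1) _ qf qg] by simp
qed

text \<open>Both sides climb the same tower from \<open>Z\<close> to \<open>X\<close>. They agree at
  the bottom because \<open>qm C f Z\<close> is the first stage of the iteration of
  \<open>f\<close>.\<close>

lemma q_iter_qm:
  "(ft C ^^ i) X = Z \<Longrightarrow> q_iter C (qm C f Z) X i = q_iter C f X (Suc i)"
  by (induction i arbitrary: X) (auto simp: funpow_swap1)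

section \<open>Sections and the uniqueness of the indices of T and S\<close>

lemma Ob_tildeD:
  assumes "s \<in> Ob_tilde C"
  shows "s \<in> hom C (ft C (bd C s)) (bd C s)" "bd C s \<in> Ob C" "len C (bd C s) > 0"
    "s \<cdot> proj C (bd C s) = ident C (ft C (bd C s))"
  using assms tgt_closed by (auto simp: Ob_tilde_def hom_def bd_def)

lemma Ob_tildeI:
  assumes "s \<in> hom C (ft C X) X" "len C X > 0" "s \<cdot> proj C X = ident C (ft C X)"
  shows "s \<in> Ob_tilde C" "bd C s = X"
  using assms by (auto simp: Ob_tilde_def hom_def bd_def)

text \<open>Up to the length of the object, \<open>ft\<close> lowers the length by exactly 1 at each
  step, so the length of the i-th iterate determines i.\<close>

lemma T_index_the:
  assumes "T_index C Y r i" "Y \<in> Ob C" "r \<in> Ob_tilde C"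
  shows "(THE i. T_index C Y r i) = i"
proof (rule the_equality[where P = "T_index C Y r"])
  fix j assume "T_index C Y r j"
  with assms(1) have "i \<le> len C (bd C r)" "j \<le> len C (bd C r)"
    "(ft C ^^ i) (bd C r) = (ft C ^^ j) (bd C r)"
    by (auto simp: T_index_def)
  then show "j = i"
    using len_funpow_ft[OF Ob_tildeD(2)[OF assms(3)]] by (metis diff_diff_cancel)
qed fact

text \<open>Past the length of \<open>bd C r\<close> the iterates equal \<open>pt C\<close>, of
  length 0, while the boundary of a section has positive length. So the range bound that
  \<open>T_index\<close> states explicitly is automatic for \<open>S_index\<close>.\<close>

lemma S_index_le:
  assumes "S_index C s r i" "s \<in> Ob_tilde C" "r \<in> Ob_tilde C"
  shows "i \<le> len C (bd C r)"
proof (rule ccontr)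
  assume "\<not> i \<le> len C (bd C r)"
  then have "bd C s = pt C"
    using assms funpow_ft_beyond_len Ob_tildeD(2) by (simp add: S_index_def)
  then show False using Ob_tildeD(3)[OF assms(2)] len_pt by simp
qed

lemma S_index_the:
  assumes "S_index C s r i" "s \<in> Ob_tilde C" "r \<in> Ob_tilde C"
  shows "(THE i. S_index C s r i) = i"
proof (rule the_equality[where P = "S_index C s r"])
  fix j assume j: "S_index C s r j"
  with assms have "i \<le> len C (bd C r)" "j \<le> len C (bd C r)"
    "(ft C ^^ i) (bd C r) = (ft C ^^ j) (bd C r)"
    using S_index_le by (auto simp: S_index_def)
  then show "j = i"
    using len_funpow_ft[OF Ob_tildeD(2)[OF assms(3)]] by (metis diff_diff_cancel)
qed fact

end

section \<open>Pulling back sections, expressed through the operation s\<close>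

context c_system
begin

lemma smor_Ob_tilde:
  assumes f: "f \<in> hom C Y X" and X: "len C X > 0"
  shows "smor C f \<in> Ob_tilde C" "bd C (smor C f) = pb C (ft_mor C f) X"
    "ft C (bd C (smor C f)) = Y"
proof -
  have X': "X \<in> Ob C" using f by (rule hom_tgt)
  have g: "ft_mor C f \<in> hom C Y (ft C X)"
    using cmp_hom[OF f proj_hom[OF X']] f by (simp add: ft_mor_def hom_def)
  have "ft C (pb C (ft_mor C f) X) = Y" by (rule ft_pb[OF X' X g])
  with smor_hom[OF f X] smor_section[OF f X] len_pb[OF X' X g]
  show "smor C f \<in> Ob_tilde C" "bd C (smor C f) = pb C (ft_mor C f) X"
    "ft C (bd C (smor C f)) = Y"
    using Ob_tildeI[of "smor C f" "pb C (ft_mor C f) X"] by auto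
qed

text \<open>For a section, \<open>ft_mor C s\<close> is an identity, so the canonical pull-back and
  its q are trivial and the factorization of \<open>s\<close> reads s = \<open>smor C s\<close>
  followed by an identity.\<close>

lemma smor_of_section:
  assumes "s \<in> Ob_tilde C"
  shows "smor C s = s"
proof -
  note s = Ob_tildeD[OF assms]
  have ft: "ft_mor C s = ident C (ft C (bd C s))"
    using s(4) by (simp add: ft_mor_def bd_def)
  have "smor C s \<in> hom C (ft C (bd C s)) (bd C s)"
    using smor_hom[OF s(1,3)] s by (simp add: ft pb_ident)
  moreover have "s = smor C s \<cdot> ident C (bd C s)"
    using smor_factor[OF s(1,3)] s by (simp add: ft qm_ident)
  ultimately show ?thesis using ident_right by metis
qed

text \<open>Replaces the definite description by a formula. The axioms for \<open>smor\<close> at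
  \<open>h\<close> are the defining equations once \<open>ft_mor C h\<close> is known to be the
  iterated q, which holds because \<open>r\<close> is a section. The index is written
  \<open>Suc i\<close> because the construction starts at 1.\<close>

lemma sec_iter_eq_smor:
  assumes r: "r \<in> Ob_tilde C" and i: "Suc i \<le> len C (bd C r)"
    and f: "f \<in> hom C Y ((ft C ^^ Suc i) (bd C r))"
  defines "h \<equiv> q_iter C f (ft C (bd C r)) i \<cdot> r"
  shows "h \<in> hom C (pb_iter C f (ft C (bd C r)) i) (bd C r)"
    and "ft_mor C h = q_iter C f (ft C (bd C r)) i"
    and "sec_iter C f r (Suc i) = smor C h"
proof -
  define X where "X = bd C r"
  define W where "W = pb_iter C f (ft C X) i"
  define q where "q = q_iter C f (ft C X) i"
  note rD = Ob_tildeD[OF r, folded X_def]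
  have q: "q \<in> hom C W (ft C X)"
    unfolding q_def W_def X_def using rD(2) i f by (intro q_iter_prev_hom) (auto simp: X_def)
  have h: "h = q \<cdot> r" by (simp add: h_def q_def X_def)
  have hh: "h \<in> hom C W X" unfolding h by (rule cmp_hom[OF q rD(1)])
  have ft: "ft_mor C h = q"
  proof -
    have "ft_mor C h = (q \<cdot> r) \<cdot> proj C X" using hh by (simp add: ft_mor_def hom_def h)
    also have "\<dots> = q \<cdot> (r \<cdot> proj C X)" by (rule cmp_assoc[OF q rD(1) proj_hom[OF rD(2)]])
    also have "\<dots> = q" using rD(4) ident_right[OF q] by simp
    finally show ?thesis .
  qed
  show "h \<in> hom C (pb_iter C f (ft C (bd C r)) i) (bd C r)" using hh by (simp add: W_def X_def)
  show "ft_mor C h = q_iter C f (ft C (bd C r)) i" using ft by (simp add: q_def X_def)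
  have pbW: "ft C (pb C q X) = W" by (rule ft_pb[OF rD(2,3) q])
  have "(THE k. k \<in> hom C W (pb C q X) \<and> k \<cdot> proj C (pb C q X) = ident C W
      \<and> k \<cdot> qm C q X = q \<cdot> r) = smor C h"
  proof (rule the_equality)
    show "smor C h \<in> hom C W (pb C q X) \<and> smor C h \<cdot> proj C (pb C q X) = ident C W
      \<and> smor C h \<cdot> qm C q X = q \<cdot> r"
      using smor_hom[OF hh rD(3)] smor_section[OF hh rD(3)] smor_factor[OF hh rD(3)]
      by (simp add: ft flip: h)
  next
    fix k assume k: "k \<in> hom C W (pb C q X) \<and> k \<cdot> proj C (pb C q X) = ident C W
      \<and> k \<cdot> qm C q X = q \<cdot> r"
    then have "k \<in> Ob_tilde C"
      using Ob_tildeI(1)[of k "pb C q X"] pbW len_pb[OF rD(2,3) q] by simp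
    \<comment> \<open>Uniqueness: a candidate \<open>k\<close> is a section, hence its own s, and
      its target is a pull-back of \<open>X\<close>, so \<open>smor_qm\<close> makes that s depend
      only on \<open>k\<close> followed by q, which is \<open>h\<close>.\<close>
    then have "k = smor C k" by (simp add: smor_of_section)
    also have "\<dots> = smor C (k \<cdot> qm C q X)"
      using k len_pb[OF rD(2,3) q] rD q pbW by (intro smor_qm) auto
    finally show "k = smor C h" using k h by simp
  qed
  then show "sec_iter C f r (Suc i) = smor C h"
    by (simp add: sec_iter_def Let_def flip: X_def q_def W_def)
qed

lemma sec_iter_Ob_tilde:
  assumes r: "r \<in> Ob_tilde C" and i: "Suc i \<le> len C (bd C r)"
    and f: "f \<in> hom C Y ((ft C ^^ Suc i) (bd C r))"
  shows "sec_iter C f r (Suc i) \<in> Ob_tilde C"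
    and "bd C (sec_iter C f r (Suc i)) = pb_iter C f (bd C r) (Suc i)"
  using smor_Ob_tilde[OF sec_iter_eq_smor(1)[OF assms] Ob_tildeD(3)[OF r]]
  by (simp_all add: sec_iter_eq_smor(2,3)[OF assms])

lemma sec_iter_ident:
  assumes r: "r \<in> Ob_tilde C" and i: "Suc i \<le> len C (bd C r)"
  shows "sec_iter C (ident C ((ft C ^^ Suc i) (bd C r))) r (Suc i) = r"
proof -
  let ?X = "bd C r" and ?Y = "(ft C ^^ Suc i) (bd C r)"
  note rD = Ob_tildeD[OF r]
  have "?Y \<in> Ob C" by (rule funpow_ft_closed[OF rD(2)])
  then have id: "ident C ?Y \<in> hom C ?Y ?Y" by (rule ident_hom)
  have "q_iter C (ident C ?Y) (ft C ?X) i = ident C (ft C ?X)"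
    using q_iter_ident[of "ft C ?X" i] rD i by (simp add: ft_closed len_ft funpow_swap1)
  then show ?thesis
    using sec_iter_eq_smor(3)[OF r i id] ident_left[OF rD(1)] smor_of_section[OF r] by simp
qed

text \<open>Both sides are s of a composite: on the left of (qf qg) r, on the right of qf t with t
  the pull-back of \<open>r\<close> along \<open>g\<close>. The axiom \<open>smor_qm\<close>
  compares them, since t followed by q(qg,X) is qg r.\<close>

lemma sec_iter_cmp:
  assumes r: "r \<in> Ob_tilde C" and i: "Suc i \<le> len C (bd C r)"
    and f: "f \<in> hom C Z Y" and g: "g \<in> hom C Y ((ft C ^^ Suc i) (bd C r))"
  shows "sec_iter C (f \<cdot> g) r (Suc i) = sec_iter C f (sec_iter C g r (Suc i)) (Suc i)"
proof -
  define X where "X = bd C r"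
  define V where "V = pb_iter C g (ft C X) i"
  define qg where "qg = q_iter C g (ft C X) i"
  define qf where "qf = q_iter C f V i"
  define t where "t = sec_iter C g r (Suc i)"
  note rD = Ob_tildeD[OF r, folded X_def]
  have gX: "X \<in> Ob C" "Suc i \<le> len C X" "g \<in> hom C Y ((ft C ^^ Suc i) X)"
    using rD(2) i g by (simp_all add: X_def)
  have qg: "qg \<in> hom C V (ft C X)"
    unfolding qg_def V_def by (rule q_iter_prev_hom[OF gX])
  have t: "t \<in> Ob_tilde C" "bd C t = pb C qg X"
    using sec_iter_Ob_tilde[OF r i g] by (simp_all add: t_def qg_def X_def)
  have ftt: "ft C (bd C t) = V" using ft_pb[OF rD(2,3) qg] t(2) by simp
  have bt: "bd C t = pb_iter C g X (Suc i)" by (simp add: t(2) qg_def)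
  have f': "f \<in> hom C Z ((ft C ^^ Suc i) (bd C t))" "Suc i \<le> len C (bd C t)"
    using funpow_ft_pb_iter[OF gX] len_pb_iter[OF gX] f by (simp_all only: bt)
  have q1: "q_iter C (f \<cdot> g) (ft C X) i = qf \<cdot> qg"
    using iter_cmp[of "ft C X" i f Z Y g] gX f
    by (simp add: ft_closed len_ft funpow_swap1 qf_def qg_def V_def)
  define U where "U = pb_iter C f V i"
  have qf: "qf \<in> hom C U V"
    using q_iter_prev_hom[OF Ob_tildeD(2)[OF t(1)] f'(2,1)] by (simp add: ftt qf_def U_def)
  note tD = Ob_tildeD[OF t(1), unfolded t(2)]
  have tt: "t \<in> hom C V (pb C qg X)" using tD(1) ftt t(2) by simp
  have tq: "t \<cdot> qm C qg X = qg \<cdot> r"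
  proof -
    note e = sec_iter_eq_smor[OF r i g, folded X_def, folded qg_def V_def]
    show ?thesis using smor_factor[OF e(1) rD(3)] by (simp add: e(2,3) t_def)
  qed
  have "sec_iter C f t (Suc i) = smor C (qf \<cdot> t)"
    using sec_iter_eq_smor(3)[OF t(1) f'(2,1)] by (simp add: ftt qf_def)
  \<comment> \<open>The target of \<open>t\<close> is the pull-back of \<open>X\<close> along
    \<open>qg\<close>, so composing with q leaves s unchanged.\<close>
  also have "\<dots> = smor C (qf \<cdot> t \<cdot> qm C qg X)"
    using cmp_hom[OF qf tt] tD rD qg ftt t(2) by (intro smor_qm) auto
  also have "qf \<cdot> t \<cdot> qm C qg X = qf \<cdot> (qg \<cdot> r)"
    using cmp_assoc[OF qf tt qm_hom[OF rD(2,3) qg]] tq by simp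
  also have "\<dots> = (qf \<cdot> qg) \<cdot> r" using cmp_assoc[OF qf qg rD(1)] by simp
  also have "smor C \<dots> = sec_iter C (f \<cdot> g) r (Suc i)"
    using sec_iter_eq_smor(3)[OF r i cmp_hom[OF f g]] by (simp add: q1 flip: X_def)
  finally show ?thesis by (simp add: t_def)
qed

lemma sec_iter_qm:
  assumes r: "r \<in> Ob_tilde C" and i: "Suc i \<le> len C (bd C r)"
    and Z: "(ft C ^^ Suc i) (bd C r) = Z" "len C Z > 0" and f: "f \<in> hom C Y (ft C Z)"
  shows "sec_iter C (qm C f Z) r (Suc i) = sec_iter C f r (Suc (Suc i))"
proof -
  note rD = Ob_tildeD[OF r]
  \<comment> \<open>Positive length of \<open>Z\<close> leaves room for one more \<open>ft\<close>
    below it, so the index i+2 is admissible.\<close>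
  have len: "Suc (Suc i) \<le> len C (bd C r)"
    using len_funpow_ft[OF rD(2) i] Z by simp
  have Zc: "Z \<in> Ob C" using funpow_ft_closed[OF rD(2)] Z(1) by blast
  have "q_iter C (qm C f Z) (ft C (bd C r)) i = q_iter C f (ft C (bd C r)) (Suc i)"
    using Z(1) by (intro q_iter_qm) (simp add: funpow_swap1)
  then show ?thesis
    using sec_iter_eq_smor(3)[OF r i] qm_hom[OF Zc Z(2) f] Z(1)
      sec_iter_eq_smor(3)[OF r len] f by simp
qed

lemma delta_Ob_tilde:
  assumes "X \<in> Ob C" "len C X > 0"
  shows "delta C X \<in> Ob_tilde C" "bd C (delta C X) = pb C (proj C X) X"
    "ft C (bd C (delta C X)) = X" "len C (bd C (delta C X)) = Suc (len C X)"
proof -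
  have id: "ident C X \<in> hom C X X" by (rule ident_hom[OF assms(1)])
  note ft = ft_mor_ident[OF assms(1)]
  show "delta C X \<in> Ob_tilde C" "bd C (delta C X) = pb C (proj C X) X"
    "ft C (bd C (delta C X)) = X"
    using smor_Ob_tilde[OF id assms(2)] by (simp_all add: delta_def ft)
  then show "len C (bd C (delta C X)) = Suc (len C X)"
    using len_pb_Suc[OF assms proj_hom[OF assms(1)]] by simp
qed

text \<open>The diagonal followed by q(p,X) is the identity of \<open>X\<close>. Hence
  \<open>f\<close> followed by the diagonal and then by q is \<open>f\<close>, and
  \<open>smor_qm\<close> says that this last q does not change s.\<close>

lemma sec_iter_delta:
  assumes f: "f \<in> hom C Y X" and X: "len C X > 0"
  shows "sec_iter C f (delta C X) (Suc 0) = smor C f"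
proof -
  have Xc: "X \<in> Ob C" using f by (rule hom_tgt)
  note d = delta_Ob_tilde[OF Xc X]
  note dD = Ob_tildeD[OF d(1), unfolded d(3)]
  have id: "ident C X \<in> hom C X X" by (rule ident_hom[OF Xc])
  have p: "proj C X \<in> hom C X (ft C X)" by (rule proj_hom[OF Xc])
  note ft = ft_mor_ident[OF Xc]
  have "sec_iter C f (delta C X) (Suc 0) = smor C (f \<cdot> delta C X)"
    using sec_iter_eq_smor(3)[OF d(1), of 0 f Y] f d by simp
  also have "\<dots> = smor C (f \<cdot> delta C X \<cdot> qm C (proj C X) X)"
    using cmp_hom[OF f dD(1)] dD X Xc d p by (intro smor_qm) auto
  also have "f \<cdot> delta C X \<cdot> qm C (proj C X) X = f \<cdot> (delta C X \<cdot> qm C (proj C X) X)"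
    using cmp_assoc[OF f dD(1)] qm_hom[OF Xc X p] d(2) by simp
  also have "delta C X \<cdot> qm C (proj C X) X = ident C X"
    using smor_factor[OF id X] by (simp add: delta_def ft)
  also have "f \<cdot> ident C X = f" by (rule ident_right[OF f])
  finally show ?thesis .
qed

end

section \<open>The subsystem built from a closed pair (B, Bt)\<close>

definition stable_mor ::
    "('o, 'm, 'z) c0_system_scheme \<Rightarrow> 'o set \<Rightarrow> 'm set \<Rightarrow> 'm set" where
  "stable_mor C B Bt = {f \<in> Mor C. src C f \<in> B \<and> tgt C f \<in> B \<and>
     (\<forall>r \<in> Bt. \<forall>i. Suc i \<le> len C (bd C r) \<and> (ft C ^^ Suc i) (bd C r) = tgt C f
        \<longrightarrow> sec_iter C f r (Suc i) \<in> Bt)}"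

lemma stable_morI:
  assumes "f \<in> hom C X Y" "X \<in> B" "Y \<in> B"
    and "\<And>r i. \<lbrakk>r \<in> Bt; Suc i \<le> len C (bd C r); (ft C ^^ Suc i) (bd C r) = Y\<rbrakk>
      \<Longrightarrow> sec_iter C f r (Suc i) \<in> Bt"
  shows "f \<in> stable_mor C B Bt"
  using assms by (auto simp: stable_mor_def hom_def)

lemma stable_morD:
  assumes "f \<in> stable_mor C B Bt"
  shows "f \<in> hom C (src C f) (tgt C f)" "src C f \<in> B" "tgt C f \<in> B"
    "\<lbrakk>r \<in> Bt; Suc i \<le> len C (bd C r); (ft C ^^ Suc i) (bd C r) = tgt C f\<rbrakk>
      \<Longrightarrow> sec_iter C f r (Suc i) \<in> Bt"
  using assms by (auto simp: stable_mor_def hom_def)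

text \<open>Carries the six closure conditions as standing hypotheses; \<open>delta_defined\<close>
  reduces to positive length because B consists of objects.\<close>

locale closed_pair = c_system C for C :: "('o, 'm) c_system" (structure) +
  fixes B :: "'o set" and Bt :: "'m set"
  assumes B_sub: "B \<subseteq> Ob C" and Bt_sub: "Bt \<subseteq> Ob_tilde C"
    and pt_B: "pt C \<in> B"
    and ft_B: "X \<in> B \<Longrightarrow> ft C X \<in> B"
    and bd_B: "s \<in> Bt \<Longrightarrow> bd C s \<in> B"
    and T_Bt: "\<lbrakk>Y \<in> B; r \<in> Bt; T_defined C Y r\<rbrakk> \<Longrightarrow> T_tilde C Y r \<in> Bt"
    and S_Bt: "\<lbrakk>s \<in> Bt; r \<in> Bt; S_defined C s r\<rbrakk> \<Longrightarrow> S_tilde C s r \<in> Bt"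
    and delta_Bt: "\<lbrakk>X \<in> B; len C X > 0\<rbrakk> \<Longrightarrow> delta C X \<in> Bt"
begin

abbreviation "M \<equiv> stable_mor C B Bt"

lemma B_Ob: "X \<in> B \<Longrightarrow> X \<in> Ob C"
  using B_sub by blast

lemma Bt_Ob_tilde: "s \<in> Bt \<Longrightarrow> s \<in> Ob_tilde C"
  using Bt_sub by blast

lemma ident_stable:
  assumes "X \<in> B"
  shows "ident C X \<in> M"
proof (rule stable_morI[OF ident_hom[OF B_Ob] assms assms])
  fix r i
  assume r: "r \<in> Bt" "Suc i \<le> len C (bd C r)" "(ft C ^^ Suc i) (bd C r) = X"
  then show "sec_iter C (ident C X) r (Suc i) \<in> Bt"
    using sec_iter_ident[OF Bt_Ob_tilde[OF r(1)] r(2)] by (simp only: r(1,3))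
qed fact

lemma cmp_stable:
  assumes f: "f \<in> M" and g: "g \<in> M" and eq: "tgt C f = src C g"
  shows "f \<cdot> g \<in> M"
proof (rule stable_morI)
  have fh: "f \<in> hom C (src C f) (src C g)" using stable_morD(1)[OF f] eq by simp
  note gh = stable_morD(1)[OF g]
  show "f \<cdot> g \<in> hom C (src C f) (tgt C g)" by (rule cmp_hom[OF fh gh])
  fix r i
  assume r: "r \<in> Bt" "Suc i \<le> len C (bd C r)" "(ft C ^^ Suc i) (bd C r) = tgt C g"
  note rt = Bt_Ob_tilde[OF r(1)]
  have gh': "g \<in> hom C (src C g) ((ft C ^^ Suc i) (bd C r))" using gh r(3) by simp
  note rD = Ob_tildeD[OF rt]
  let ?t = "sec_iter C g r (Suc i)"
  have t: "?t \<in> Bt" by (rule stable_morD(4)[OF g r])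
  note bt = sec_iter_Ob_tilde(2)[OF rt r(2) gh']
  \<comment> \<open>The boundary of \<open>?t\<close> lies i+1 levels above the source of
    \<open>g\<close>, which is the target of \<open>f\<close>, so stability of \<open>f\<close>
    applies to \<open>?t\<close> at the same index.\<close>
  have "sec_iter C f ?t (Suc i) \<in> Bt"
    using funpow_ft_pb_iter[OF rD(2) r(2) gh'] len_pb_iter[OF rD(2) r(2) gh'] eq
    by (intro stable_morD(4)[OF f t]) (simp_all only: bt)
  then show "sec_iter C (f \<cdot> g) r (Suc i) \<in> Bt"
    using sec_iter_cmp[OF rt r(2) fh gh'] by simp
qed (use stable_morD[OF f] stable_morD[OF g] in auto)

lemma proj_stable:
  assumes Y: "Y \<in> B"
  shows "proj C Y \<in> M"
proof (cases "len C Y = 0")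
  case True
  then have "Y = pt C" using len_0_iff B_Ob[OF Y] by blast
  \<comment> \<open>The operation T requires positive length, so \<open>pt\<close> is treated apart:
    its projection is an endomorphism of a final object.\<close>
  moreover have "proj C (pt C) = ident C (pt C)"
    using pt_final[OF pt_closed] proj_hom[OF pt_closed] ident_hom[OF pt_closed] ft_pt by auto
  ultimately show ?thesis using ident_stable[OF pt_B] by simp
next
  case False
  show ?thesis
  proof (rule stable_morI[OF proj_hom[OF B_Ob] Y ft_B])
    fix r i
    assume r: "r \<in> Bt" "Suc i \<le> len C (bd C r)" "(ft C ^^ Suc i) (bd C r) = ft C Y"
    have "T_index C Y r (Suc i)" unfolding T_index_def using r False by simp
    then show "sec_iter C (proj C Y) r (Suc i) \<in> Bt"
      using T_Bt[OF Y r(1)] T_index_the[of Y r "Suc i"] B_Ob[OF Y] Bt_Ob_tilde[OF r(1)]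
      by (auto simp: T_defined_def T_tilde_def)
  qed (use Y in auto)
qed

lemma Bt_stable:
  assumes s: "s \<in> Bt"
  shows "s \<in> M"
proof (rule stable_morI[OF Ob_tildeD(1)])
  show "s \<in> Ob_tilde C" by (rule Bt_Ob_tilde[OF s])
  fix r i
  assume r: "r \<in> Bt" "Suc i \<le> len C (bd C r)" "(ft C ^^ Suc i) (bd C r) = bd C s"
  then have "S_index C s r (Suc i)" by (simp add: S_index_def)
  then show "sec_iter C s r (Suc i) \<in> Bt"
    using S_Bt[OF s r(1)] S_index_the[of s r "Suc i"] Bt_Ob_tilde[OF s] Bt_Ob_tilde[OF r(1)]
    by (auto simp: S_defined_def S_tilde_def)
qed (use bd_B[OF s] ft_B in auto)

lemma smor_Bt:
  assumes f: "f \<in> M" and X: "len C (tgt C f) > 0"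
  shows "smor C f \<in> Bt"
proof -
  note fD = stable_morD[OF f]
  note d = delta_Ob_tilde[OF B_Ob[OF fD(3)] X]
  have "sec_iter C f (delta C (tgt C f)) (Suc 0) \<in> Bt"
    using d delta_Bt[OF fD(3) X] by (intro fD(4)) auto
  then show ?thesis using sec_iter_delta[OF fD(1) X] by simp
qed

text \<open>Stability speaks of sections only, so the object has to be read off from one. The
  diagonal of \<open>X\<close> has boundary \<open>?V\<close> with \<open>ft C ?V = X\<close>, which
  puts \<open>ft C X\<close> two levels below \<open>?V\<close>; the source of the diagonal pulled
  back along \<open>f\<close> at index 2 is then the pull-back of \<open>X\<close>.\<close>

lemma pb_B:
  assumes f: "f \<in> M" and X: "X \<in> B" "len C X > 0" and eq: "tgt C f = ft C X"
  shows "pb C f X \<in> B"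
proof -
  note fD = stable_morD[OF f, unfolded eq]
  have Xc: "X \<in> Ob C" by (rule B_Ob[OF X(1)])
  note d = delta_Ob_tilde[OF Xc X(2)]
  let ?V = "bd C (delta C X)"
  have V: "?V \<in> Ob C" "Suc (Suc 0) \<le> len C ?V" "(ft C ^^ Suc (Suc 0)) ?V = ft C X"
    using d X(2) Ob_tildeD(2)[OF d(1)] by (simp_all add: d(3))
  have fh: "f \<in> hom C (src C f) ((ft C ^^ Suc (Suc 0)) ?V)"
    using fD(1) V(3) by (simp only:)
  have "sec_iter C f (delta C X) (Suc (Suc 0)) \<in> Bt"
    by (rule fD(4)[OF delta_Bt[OF X] V(2,3)])
  then have "ft C (bd C (sec_iter C f (delta C X) (Suc (Suc 0)))) \<in> B"
    by (intro ft_B bd_B)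
  also have "bd C (sec_iter C f (delta C X) (Suc (Suc 0))) = pb_iter C f ?V (Suc (Suc 0))"
    by (rule sec_iter_Ob_tilde(2)[OF d(1) V(2) fh])
  also have "ft C \<dots> = pb_iter C f (ft C ?V) (Suc 0)"
    by (rule ft_pb_iter_Suc[OF V(1,2) fh])
  finally show ?thesis by (simp add: d(3))
qed

text \<open>By \<open>sec_iter_qm\<close>, pulling a section back along q(f,X) is pulling it back
  along \<open>f\<close> with the index raised by one, which stability of \<open>f\<close>
  covers.\<close>

lemma qm_stable:
  assumes f: "f \<in> M" and X: "X \<in> B" "len C X > 0" and eq: "tgt C f = ft C X"
  shows "qm C f X \<in> M"
proof (rule stable_morI)
  note fD = stable_morD[OF f, unfolded eq]
  show "qm C f X \<in> hom C (pb C f X) X" by (rule qm_hom[OF B_Ob[OF X(1)] X(2) fD(1)])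
  show "pb C f X \<in> B" by (rule pb_B[OF assms])
  fix r i
  assume r: "r \<in> Bt" "Suc i \<le> len C (bd C r)" "(ft C ^^ Suc i) (bd C r) = X"
  note rt = Bt_Ob_tilde[OF r(1)]
  have "Suc (Suc i) \<le> len C (bd C r)"
    using len_funpow_ft[OF Ob_tildeD(2)[OF rt] r(2)] r(3) X(2) by simp
  moreover have "(ft C ^^ Suc (Suc i)) (bd C r) = ft C X" using r(3) by simp
  ultimately have "sec_iter C f r (Suc (Suc i)) \<in> Bt" by (rule fD(4)[OF r(1)])
  then show "sec_iter C (qm C f X) r (Suc i) \<in> Bt"
    using sec_iter_qm[OF rt r(2,3) X(2) fD(1)] by simp
qed fact

lemma subsystem_exists: "\<exists>C'. c_subsystem C' C \<and> Ob C' = B \<and> Ob_tilde C' = Bt"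
proof (intro exI conjI)
  let ?C = "C\<lparr>Ob := B, Mor := M\<rparr>"
  have "M \<subseteq> Mor C" by (auto simp: stable_mor_def)
  then show "c_subsystem ?C C"
    unfolding c_subsystem_def
    by (intro conjI ballI impI)
      (simp_all add: B_sub stable_morD(2,3) ident_stable cmp_stable pt_B ft_B proj_stable pb_B
        qm_stable Bt_stable smor_Bt)
  have "Ob_tilde ?C = Ob_tilde C \<inter> M"
    by (auto simp: Ob_tilde_def stable_mor_def)
  also have "\<dots> = Bt"
  proof (intro equalityI subsetI)
    \<comment> \<open>A stable section equals its own s, and s of a stable morphism lies in Bt, so
      no new sections appear.\<close>
    fix s assume "s \<in> Ob_tilde C \<inter> M"
    then show "s \<in> Bt"
      using smor_Bt[of s] smor_of_section[of s] Ob_tildeD(3)[of s] by (simp add: bd_def)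
  qed (simp add: Bt_Ob_tilde Bt_stable)
  finally show "Ob_tilde ?C = Bt" .
qed simp

end

section \<open>Closure of a given subsystem under T, S and the diagonal\<close>

locale subsystem = c_system C for C C' :: "('o, 'm) c_system" +
  assumes sub: "c_subsystem C' C"
begin

lemma Ob_sub: "X \<in> Ob C' \<Longrightarrow> X \<in> Ob C"
  and Mor_sub: "f \<in> Mor C' \<Longrightarrow> f \<in> Mor C"
  and sub_src: "f \<in> Mor C' \<Longrightarrow> src C f \<in> Ob C'"
  and sub_tgt: "f \<in> Mor C' \<Longrightarrow> tgt C f \<in> Ob C'"
  and sub_ident: "X \<in> Ob C' \<Longrightarrow> ident C X \<in> Mor C'"
  and sub_cmp: "\<lbrakk>f \<in> Mor C'; g \<in> Mor C'; tgt C f = src C g\<rbrakk> \<Longrightarrow> f \<cdot>\<^bsub>C\<^esub> g \<in> Mor C'"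
  and sub_pt: "pt C \<in> Ob C'"
  and sub_ft: "X \<in> Ob C' \<Longrightarrow> ft C X \<in> Ob C'"
  and sub_proj: "X \<in> Ob C' \<Longrightarrow> proj C X \<in> Mor C'"
  and sub_qm: "\<lbrakk>X \<in> Ob C'; f \<in> Mor C'; len C X > 0; tgt C f = ft C X\<rbrakk> \<Longrightarrow> qm C f X \<in> Mor C'"
  and sub_smor: "\<lbrakk>f \<in> Mor C'; len C (tgt C f) > 0\<rbrakk> \<Longrightarrow> smor C f \<in> Mor C'"
  using sub unfolding c_subsystem_def by auto

lemma Ob_tilde_sub: "Ob_tilde C' = Ob_tilde C \<inter> Mor C'"
proof -
  obtain O' M' where C': "C' = C\<lparr>Ob := O', Mor := M'\<rparr>"
    using sub unfolding c_subsystem_def by blast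
  then have "M' \<subseteq> Mor C" using Mor_sub by auto
  then show ?thesis by (auto simp: Ob_tilde_def C')
qed

lemma q_iter_sub:
  "\<lbrakk>X \<in> Ob C'; i \<le> len C X; f \<in> Mor C'; tgt C f = (ft C ^^ i) X\<rbrakk> \<Longrightarrow> q_iter C f X i \<in> Mor C'"
proof (induction i arbitrary: X)
  case (Suc i)
  have X: "X \<in> Ob C" by (rule Ob_sub[OF Suc.prems(1)])
  have "f \<in> hom C (src C f) ((ft C ^^ Suc i) X)"
    using Mor_sub[OF Suc.prems(3)] Suc.prems(4) by (simp add: hom_def)
  from q_iter_prev_hom[OF X Suc.prems(2) this]
  have "tgt C (q_iter C f (ft C X) i) = ft C X" by (simp add: hom_def)
  moreover have "q_iter C f (ft C X) i \<in> Mor C'"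
    using Suc.prems X by (intro Suc.IH) (simp_all add: sub_ft len_ft funpow_swap1)
  ultimately show ?case using Suc.prems by (auto intro: sub_qm)
qed simp

text \<open>The formula of \<open>sec_iter_eq_smor\<close> builds the pulled-back section from q,
  composition and s, and a subsystem is closed under all three.\<close>

lemma sec_iter_sub:
  assumes r: "r \<in> Ob_tilde C'" and i: "Suc i \<le> len C (bd C r)"
    and f: "f \<in> Mor C'" "tgt C f = (ft C ^^ Suc i) (bd C r)"
  shows "sec_iter C f r (Suc i) \<in> Ob_tilde C'"
proof -
  have rt: "r \<in> Ob_tilde C" and rM: "r \<in> Mor C'" using r by (auto simp: Ob_tilde_sub)
  note rD = Ob_tildeD[OF rt]
  have X: "bd C r \<in> Ob C'" using sub_tgt[OF rM] by (simp add: bd_def)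
  have fh: "f \<in> hom C (src C f) ((ft C ^^ Suc i) (bd C r))"
    using Mor_sub[OF f(1)] f(2) by (simp add: hom_def)
  let ?q = "q_iter C f (ft C (bd C r)) i"
  have "?q \<in> Mor C'"
    using i f X rD by (intro q_iter_sub) (simp_all add: sub_ft len_ft funpow_swap1)
  then have "?q \<cdot>\<^bsub>C\<^esub> r \<in> Mor C'"
    using q_iter_prev_hom[OF rD(2) i fh] rD(1) rM by (intro sub_cmp) (simp_all add: hom_def)
  then have "smor C (?q \<cdot>\<^bsub>C\<^esub> r) \<in> Mor C'"
    using sec_iter_eq_smor(1)[OF rt i fh] rD(3) by (intro sub_smor) (simp_all add: hom_def)
  then show ?thesis
    using sec_iter_eq_smor(3)[OF rt i fh] sec_iter_Ob_tilde(1)[OF rt i fh]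
    by (simp add: Ob_tilde_sub)
qed

lemma bd_sub: "s \<in> Ob_tilde C' \<Longrightarrow> bd C s \<in> Ob C'"
  using sub_tgt by (auto simp: Ob_tilde_sub bd_def)

lemma T_tilde_sub:
  assumes Y: "Y \<in> Ob C'" and r: "r \<in> Ob_tilde C'" and T: "T_defined C Y r"
  shows "T_tilde C Y r \<in> Ob_tilde C'"
proof -
  have rt: "r \<in> Ob_tilde C" using r by (simp add: Ob_tilde_sub)
  obtain i where i: "T_index C Y r i" using T by (auto simp: T_defined_def)
  \<comment> \<open>An admissible index is at least 1, which matches the \<open>Suc\<close> form of
    the lemmas on \<open>sec_iter\<close>.\<close>
  then obtain j where j: "i = Suc j" by (cases i) (auto simp: T_index_def)
  have "sec_iter C (proj C Y) r (Suc j) \<in> Ob_tilde C'"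
    using i j proj_hom[OF Ob_sub[OF Y]]
    by (intro sec_iter_sub[OF r] sub_proj[OF Y]) (auto simp: T_index_def hom_def)
  then show ?thesis
    using T_index_the[OF i Ob_sub[OF Y] rt] j by (simp add: T_tilde_def)
qed

lemma S_tilde_sub:
  assumes s: "s \<in> Ob_tilde C'" and r: "r \<in> Ob_tilde C'" and S: "S_defined C s r"
  shows "S_tilde C s r \<in> Ob_tilde C'"
proof -
  have rt: "r \<in> Ob_tilde C" and st: "s \<in> Ob_tilde C" and sM: "s \<in> Mor C'"
    using r s by (simp_all add: Ob_tilde_sub)
  obtain i where i: "S_index C s r i" using S by (auto simp: S_defined_def)
  then obtain j where j: "i = Suc j" by (cases i) (auto simp: S_index_def)
  have "sec_iter C s r (Suc j) \<in> Ob_tilde C'"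
    using i j S_index_le[OF i st rt]
    by (intro sec_iter_sub[OF r _ sM]) (auto simp: S_index_def bd_def)
  then show ?thesis
    using S_index_the[OF i st rt] j by (simp add: S_tilde_def)
qed

lemma delta_sub:
  assumes X: "X \<in> Ob C'" "len C X > 0"
  shows "delta C X \<in> Ob_tilde C'"
  using delta_Ob_tilde(1)[OF Ob_sub[OF X(1)] X(2)] sub_smor[OF sub_ident[OF X(1)]]
    ident_hom[OF Ob_sub[OF X(1)]] X(2)
  by (simp add: Ob_tilde_sub delta_def hom_def)

end

section \<open>The equivalence, assembled from the two directions\<close>

theorem proposition0p4p3:
  fixes CC :: "('o, 'm) c_system" and B :: "'o set" and Bt :: "'m set"
  assumes "c_system CC"
    and "B \<subseteq> Ob CC"
    and "Bt \<subseteq> Ob_tilde CC"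
  shows "(\<exists>CC'. c_subsystem CC' CC \<and> Ob CC' = B \<and> Ob_tilde CC' = Bt) \<longleftrightarrow>
    pt CC \<in> B \<and>
    (\<forall>X \<in> B. ft CC X \<in> B) \<and>
    (\<forall>s \<in> Bt. bd CC s \<in> B) \<and>
    (\<forall>Y \<in> B. \<forall>r \<in> Bt. T_defined CC Y r \<longrightarrow> T_tilde CC Y r \<in> Bt) \<and>
    (\<forall>s \<in> Bt. \<forall>r \<in> Bt. S_defined CC s r \<longrightarrow> S_tilde CC s r \<in> Bt) \<and>
    (\<forall>X \<in> B. delta_defined CC X \<longrightarrow> delta CC X \<in> Bt)" (is "?ex \<longleftrightarrow> ?closed")
proof
  assume ?ex
  then obtain CC' where sub: "c_subsystem CC' CC" and [simp]: "B = Ob CC'" "Bt = Ob_tilde CC'"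
    by blast
  interpret subsystem CC CC'
    using assms(1) sub by (simp add: subsystem_def subsystem_axioms_def)
  show ?closed
    using sub_pt sub_ft bd_sub T_tilde_sub S_tilde_sub delta_sub
    by (simp add: delta_defined_def)
next
  assume closed: ?closed
  interpret c_system CC by fact
  interpret closed_pair CC B Bt
    using assms closed by unfold_locales (auto simp: delta_defined_def)
  show ?ex by (rule subsystem_exists)
qed

end
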